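(* Let $\phi:=F+\tilde\varphi\circ\boldsymbol{B}:\mathbb{R}^d\to\mathbb{R}$ be the sum of the Poisson fidelity term $F$ and the smoothed higher-order isotropic total variation $\tilde\varphi\circ\boldsymbol{B}$ (both defined in the context), let $L_\phi$ be the Lipschitz constant of $\nabla\phi$, let $\iota$ be the indicator function of $\mathbb{R}_+^d$, put $\Phi:=\phi+\iota$, and let $\boldsymbol{f}^*$ be a global minimizer of $\Phi$. Let $\boldsymbol{P}$ be a $d\times d$ diagonal matrix with positive diagonal entries, let $p_{\max}$ be its maximal diagonal entry, and let $\mathcal{T}:\mathbb{R}^d\to\mathbb{R}^d$ be given by $\mathcal{T}(\boldsymbol{x}):=\mathrm{prox}_{\iota,\boldsymbol{P}^{-1}}(\boldsymbol{x}-\boldsymbol{P}\nabla\phi(\boldsymbol{x}))$. Given $\boldsymbol{f}^0,\boldsymbol{f}^1\in\mathbb{R}^d$, let $\{\boldsymbol{f}^k\}_{k\in\mathbb{N}}$ be generated by $$\tilde{\boldsymbol{f}}^k=\boldsymbol{f}^k+\theta_k(\boldsymbol{f}^k-\boldsymbol{f}^{k-1}),\qquad \boldsymbol{f}^{k+1}=\mathcal{T}\tilde{\boldsymbol{f}}^k,\qquad k\in\mathbb{N}_+.$$ Suppose that $\theta_k=\frac{t_{k-1}-1}{t_k}$ for $k\in\mathbb{N}_+$, where $t_k:=ak^{\omega}+b$ for $k\in\mathbb{N}$ and $b\in\mathbb{R}\setminus\{-ak^{\omega}:k\in\mathbb{N}_+\}$. If $p_{\max}\leq\frac{1}{L_\phi}$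 and either $\omega\in(0,1)$, $a\in(0,+\infty)$ or $\omega=1$, $a\in(0,\frac12)$ holds, then: (i) $\|\boldsymbol{f}^k-\boldsymbol{f}^{k-1}\|_2=o\left(\frac{1}{k^{\omega}}\right)$; (ii) $\Phi(\boldsymbol{f}^k)-\Phi(\boldsymbol{f}^* )=o\left(\frac{1}{k^{2\omega}}\right)$; (iii) $\{\boldsymbol{f}^k\}_{k\in\mathbb{N}}$ converges to a minimizer of $\Phi$.
   Context: $\mathbb{N}=\{0,1,2,\dots\}$, $\mathbb{N}_+=\{1,2,\dots\}$, $\mathbb{R}_+$ is the set of nonnegative reals. The indicator function is $\iota(\boldsymbol{x})=0$ if $\boldsymbol{x}\in\mathbb{R}_+^d$ and $+\infty$ otherwise. For a diagonal matrix $\boldsymbol{H}$ with positive diagonal entries, $\|\boldsymbol{x}\|_{\boldsymbol{H}}:=\langle\boldsymbol{x},\boldsymbol{H}\boldsymbol{x}\rangle^{1/2}$ and $\mathrm{prox}_{\psi,\boldsymbol{H}}(\boldsymbol{x}):=\arg\min_{\boldsymbol{u}}\{\frac12\|\boldsymbol{u}-\boldsymbol{x}\|_{\boldsymbol{H}}^2+\psi(\boldsymbol{u})\}$; in particular $\mathrm{prox}_{\iota,\boldsymbol{P}^{-1}}(\boldsymbol{x})=\max(\boldsymbol{x},\boldsymbol{0})$ componentwise. Fidelity term: $F(\boldsymbol{f}):=\langle\boldsymbol{A}\boldsymbol{f},\boldsymbol{1}_m\rangle-\langle\ln(\boldsymbol{A}\boldsymbol{f}+\boldsymbol{\gamma}),\boldsymbol{g}\rangle$,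 where $\boldsymbol{A}\in\mathbb{R}_+^{m\times d}$ is the PET system matrix, $\boldsymbol{\gamma}\in\mathbb{R}_+^m$ the average background noise, $\boldsymbol{g}\in\mathbb{R}_+^m$ the projection data, $\boldsymbol{1}_m$ the all-ones vector, and $\ln$ acts componentwise. Regularizer (2D case): $d=N^2$; $\boldsymbol{I}_N$ is the $N\times N$ identity matrix; $\boldsymbol{D}$ is the $N\times N$ matrix with $D_{j,j}=1$, $D_{j,j-1}=-1$ for $j=2,\dots,N$ and all other entries zero; $\otimes$ is the Kronecker product. $\boldsymbol{B}_1\in\mathbb{R}^{2d\times d}$ is obtained by stacking vertically $\boldsymbol{I}_N\otimes\boldsymbol{D}$ and $\boldsymbol{D}\otimes\boldsymbol{I}_N$; $\boldsymbol{B}_2\in\mathbb{R}^{4d\times d}$ by stacking vertically $\boldsymbol{I}_N\otimes(-\boldsymbol{D}^\top\boldsymbol{D})$, $(-\boldsymbol{D}^\top)\otimes\boldsymbol{D}$, $(-\boldsymbol{D}^\top\boldsymbol{D})\otimes\boldsymbol{I}_N$, $\boldsymbol{D}\otimes(-\boldsymbol{D}^\top)$; and $\boldsymbol{B}$ by stacking $\boldsymbol{B}_1$ on top of $\boldsymbol{B}_2$. For $\epsilon>0$, $s_\epsilon(\boldsymbol{x}):=\|\boldsymbol{x}\|_2-\frac{\epsilon}{2}$ if $\|\boldsymbol{x}\|_2>\epsilon$ and $s_\epsilon(\boldsymbol{x}):=\frac{1}{2\epsilon}\|\boldsymbol{x}\|_2^2$ otherwise. With regularization parameters $\lambda_1,\lambda_2\in(0,+\infty)$,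 for $\boldsymbol{x}\in\mathbb{R}^{6d}$, $$\tilde\varphi(\boldsymbol{x}):=\lambda_1\sum_{i=1}^d s_\epsilon\big((x_i,x_{d+i})^\top\big)+\lambda_2\sum_{i=1}^d s_\epsilon\big((x_{2d+i},x_{3d+i},x_{4d+i},x_{5d+i})^\top\big).$$ The function $\phi$ is treated as a real-valued, convex, differentiable function on $\mathbb{R}^d$ with Lipschitz continuous gradient; these properties are asserted in a separate lemma of the source. *)

theory Defs
  imports "HOL-Analysis.Analysis" "HOL-Library.Landau_Symbols" "HOL-Library.Extended_Real"
begin

text \<open>
  The pixels of an \<open>N \<times> N\<close> image are indexed by \<open>'n \<times> 'n\<close>, where \<open>'n\<close> is a finite linearly ordered
  type with \<open>N = CARD('n)\<close>; the pair of positions \<open>(p, q)\<close> stands for the index \<open>(p - 1) N + q\<close> of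
  the vectorised image. Thus \<open>real ^ ('n \<times> 'n)\<close> is \<open>d\<close>-dimensional space with \<open>d = N\<^sup>2\<close>.
  Vertically stacked blocks are indexed by sum types.
\<close>

type_synonym 'n img = "real ^ ('n \<times> 'n)"

type_synonym 'p two_blocks = "'p + 'p"
type_synonym 'p four_blocks = "'p + 'p + 'p + 'p"
type_synonym 'p six_blocks = "'p two_blocks + 'p four_blocks"


section \<open>Difference matrices\<close>

text \<open>The position, in \<open>1, \<dots>, N\<close>, of an index.\<close>
definition pos :: "'n::{finite,linorder} \<Rightarrow> nat" where
  "pos j = card {i. i \<le> j}"

text \<open>The row at position 1 is zero.\<close>
definition diff_mat :: "real ^ 'n::{finite,linorder} ^ 'n::{finite,linorder}" where
  "diff_mat = (\<chi> j k.
     if pos j \<ge> 2 \<and> pos k = pos j then 1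
     else if pos j \<ge> 2 \<and> pos k = pos j - 1 then - 1
     else 0)"

definition kron :: "real ^ 'b ^ 'a \<Rightarrow> real ^ 'e ^ 'c \<Rightarrow> real ^ ('b \<times> 'e) ^ ('a \<times> 'c)" where
  "kron A B = (\<chi> r s. A $ fst r $ fst s * B $ snd r $ snd s)"

definition vstack :: "real ^ 'c ^ 'a \<Rightarrow> real ^ 'c ^ 'b \<Rightarrow> real ^ 'c ^ ('a + 'b)" where
  "vstack A B = (\<chi> r. case r of Inl a \<Rightarrow> A $ a | Inr b \<Rightarrow> B $ b)"

definition B1 :: "real ^ ('n \<times> 'n) ^ ('n::{finite,linorder} \<times> 'n) two_blocks" where
  "B1 = vstack (kron (mat 1) diff_mat) (kron diff_mat (mat 1))"

definition B2 :: "real ^ ('n \<times> 'n) ^ ('n::{finite,linorder} \<times> 'n) four_blocks" where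
  "B2 = vstack (kron (mat 1) (- (transpose diff_mat ** diff_mat)))
       (vstack (kron (- transpose diff_mat) diff_mat)
       (vstack (kron (- (transpose diff_mat ** diff_mat)) (mat 1))
               (kron diff_mat (- transpose diff_mat))))"

definition B_mat :: "real ^ ('n \<times> 'n) ^ ('n::{finite,linorder} \<times> 'n) six_blocks" where
  "B_mat = vstack B1 B2"


section \<open>The objective function\<close>

definition smooth_norm :: "real \<Rightarrow> 'a::real_normed_vector \<Rightarrow> real" where
  "smooth_norm \<epsilon> x = (if norm x > \<epsilon> then norm x - \<epsilon> / 2 else 1 / (2 * \<epsilon>) * (norm x)\<^sup>2)"

definition smoothed_tv :: "real \<Rightarrow> real \<Rightarrow> real \<Rightarrow> real ^ ('p::finite) six_blocks \<Rightarrow> real" where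
  "smoothed_tv \<epsilon> lam1 lam2 x =
     lam1 * (\<Sum>i\<in>UNIV. smooth_norm \<epsilon> (vector [x $ Inl (Inl i), x $ Inl (Inr i)] :: real ^ 2)) +
     lam2 * (\<Sum>i\<in>UNIV. smooth_norm \<epsilon>
             (vector [x $ Inr (Inl i), x $ Inr (Inr (Inl i)),
                      x $ Inr (Inr (Inr (Inl i))), x $ Inr (Inr (Inr (Inr i)))] :: real ^ 4))"

definition fidelity :: "real ^ 'p ^ 'm \<Rightarrow> real ^ 'm \<Rightarrow> real ^ 'm \<Rightarrow> real ^ 'p \<Rightarrow> real" where
  "fidelity A \<gamma> g f = (A *v f) \<bullet> 1 - (\<chi> i. ln ((A *v f + \<gamma>) $ i)) \<bullet> g"

definition nonneg_orthant :: "(real ^ 'p) set" where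
  "nonneg_orthant = {x. \<forall>i. x $ i \<ge> 0}"

definition nonneg_ind :: "real ^ 'p \<Rightarrow> ereal" where
  "nonneg_ind x = (if x \<in> nonneg_orthant then 0 else \<infinity>)"

text \<open>
  The formula for \<open>\<phi>\<close>. In HOL, \<open>ln\<close> is extended by \<open>ln (- x) = ln x\<close> and \<open>ln 0 = 0\<close>, so outside the
  region where the arguments of \<open>ln\<close> are positive, the value is an artefact of that convention.
  The iteration evaluates the gradient of \<open>\<phi>\<close> at extrapolated points, which may lie outside the
  nonnegative orthant, and \<open>\<phi>\<close> has to be finite and convex there. Hence the theorem takes for \<open>\<phi>\<close> any
  convex function with Lipschitz gradient that is given by the formula on the orthant; this determines
  \<open>\<phi>\<close> plus the indicator function of the orthant. The case that the formula holds everywhere is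
  included.
\<close>
definition pet_objective ::
  "real ^ ('n \<times> 'n) ^ 'm \<Rightarrow> real ^ 'm \<Rightarrow> real ^ 'm \<Rightarrow> real \<Rightarrow> real \<Rightarrow> real \<Rightarrow>
   'n::{finite,linorder} img \<Rightarrow> real" where
  "pet_objective A \<gamma> g \<epsilon> lam1 lam2 f =
     fidelity A \<gamma> g f + smoothed_tv \<epsilon> lam1 lam2 (B_mat *v f)"


section \<open>Proximity operator and iteration map\<close>

definition wnorm :: "real ^ 'p ^ 'p \<Rightarrow> real ^ 'p \<Rightarrow> real" where
  "wnorm H x = sqrt (x \<bullet> (H *v x))"

definition prox :: "(real ^ 'p \<Rightarrow> ereal) \<Rightarrow> real ^ 'p ^ 'p \<Rightarrow> real ^ 'p \<Rightarrow> real ^ 'p" where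
  "prox \<psi> H x = (ARG_MIN (\<lambda>u. ereal (1 / 2 * (wnorm H (u - x))\<^sup>2) + \<psi> u) u. True)"

definition pos_diag :: "real ^ 'p ^ 'p \<Rightarrow> bool" where
  "pos_diag P \<longleftrightarrow> (\<forall>i j. i \<noteq> j \<longrightarrow> P $ i $ j = 0) \<and> (\<forall>i. P $ i $ i > 0)"

text \<open>The second argument is the gradient of the smooth part.\<close>
definition T_map :: "real ^ 'p ^ 'p \<Rightarrow> (real ^ 'p \<Rightarrow> real ^ 'p) \<Rightarrow> real ^ 'p \<Rightarrow> real ^ 'p" where
  "T_map P G x = prox nonneg_ind (matrix_inv P) (x - P *v G x)"

end

theory Submission
  imports Defs "HOL-Real_Asymp.Real_Asymp"
begin

text \<open>
  The proximity operator of the indicator function clips at 0 (\<open>prox_nonneg_ind\<close>), so \<open>T_map P G\<close> is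
  a projected gradient step in the metric of \<open>P\<^sup>-\<^sup>1\<close>. As no diagonal entry of \<open>P\<close> exceeds \<open>1 / L\<close>,
  the step satisfies the usual inequality of proximal gradient methods (\<open>prox_gradient_step\<close>). After
  division of the \<open>i\<close>-th coordinate by the square root of \<open>P $ i $ i\<close> the metric is Euclidean, and the
  inequality is all that the analysis of the iteration needs (locale \<open>momentum_descent\<close>).

  Let \<open>w k\<close> be the gap between the objective at the \<open>k\<close>-th iterate \<open>x k\<close> and its minimum, attained
  at \<open>z\<close>. The choice \<open>\<theta> k = (t (k - 1) - 1) / t k\<close> makes the energy
  \<open>(t (k - 1))\<^sup>2 * w k + (norm (x (k - 1) + t (k - 1) *\<^sub>R (x k - x (k - 1)) - z))\<^sup>2 / 2\<close>
  decrease by at least a multiple of \<open>t k * w k\<close> (\<open>energy_decrease\<close>), because the increments of \<open>t\<close>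
  are eventually at most a constant below \<open>1/2\<close> (\<open>schedule_eventually\<close>). Hence the sum of
  \<open>t k * w k\<close> converges.

  Now consider \<open>(t (k - 1))\<^sup>2 * (w k + (norm (x k - x (k - 1)))\<^sup>2 / 2)\<close>. Up to summable errors this
  decreases, so it has a limit (\<open>scaled_gap_step\<close>). Divided by \<open>t (k - 1)\<close> it is summable, but \<open>t\<close>
  grows at most linearly and the sum of \<open>1 / t k\<close> diverges; thus the limit is 0
  (\<open>scaled_gap_tendsto_0\<close>). Both rates follow at once.

  By the rates, the energy has the same limit as \<open>(norm (x k - z))\<^sup>2 / 2\<close>. So the distance of the
  iterates to every minimizer converges (\<open>distance_convergent\<close>), and by Opial's argument the iterates
  converge to a minimizer (\<open>iterates_converge\<close>).
\<close>


section \<open>Two facts on real sequences\<close>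

text \<open>
  Subtracting the partial sums of \<open>e\<close> from \<open>s\<close> leaves a decreasing sequence that is bounded below
  by \<open>- suminf e\<close>; the telescoped inequality then bounds the partial sums of \<open>d\<close>.
\<close>
lemma almost_decreasing_convergent:
  fixes s d e :: "nat \<Rightarrow> real"
  assumes step: "\<And>n. s (Suc n) + d n \<le> s n + e n"
    and s: "\<And>n. 0 \<le> s n" and d: "\<And>n. 0 \<le> d n" and e: "\<And>n. 0 \<le> e n" "summable e"
  shows "convergent s" "summable d"
proof -
  have le: "(\<Sum>i<n. e i) \<le> suminf e" for n
    using e by (intro sum_le_suminf) auto
  define q where "q n = s n - (\<Sum>i<n. e i)" for n
  have q_step: "q (Suc n) + d n \<le> q n" for n
    using step[of n] by (simp add: q_def)
  have "decseq q"
  proof (rule decseq_SucI)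
    show "q (Suc n) \<le> q n" for n
      using q_step[of n] d[of n] by linarith
  qed
  moreover have q_ge: "- suminf e \<le> q n" for n
    using s[of n] le[of n] by (simp add: q_def)
  ultimately have "convergent q"
    by (metis decseq_convergent convergentI)
  then have "convergent (\<lambda>n. q n + (\<Sum>i<n. e i))"
    using e(2) by (intro convergent_add) (auto simp: summable_iff_convergent)
  then show "convergent s"
    by (simp add: q_def)
  have "(\<Sum>i<n. d i) \<le> q 0 - q n" for n
  proof (induction n)
    case (Suc n)
    then show ?case using q_step[of n] by simp
  qed simp
  then have "(\<Sum>i<n. d i) \<le> q 0 + suminf e" for n
    using q_ge[of n] order_trans[of "\<Sum>i<n. d i"] by fastforce
  then show "summable d"
    using d by (intro bounded_imp_summable[where B = "q 0 + suminf e"])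
      (simp_all only: lessThan_Suc_atMost[symmetric])
qed

text \<open>
  If the limit \<open>l\<close> were positive, then \<open>s n / t n\<close> would eventually exceed a multiple of
  \<open>1 / (n + 1)\<close>, because \<open>t\<close> grows at most linearly, and the harmonic series diverges.
\<close>
lemma tendsto_0_if_summable_divide_linear:
  fixes s t :: "nat \<Rightarrow> real"
  assumes lim: "s \<longlonglongrightarrow> l" and s: "\<And>n. 0 \<le> s n"
    and t: "\<And>n. 0 < t n" and growth: "\<And>n. t n \<le> M * (real n + 1)"
    and sum: "summable (\<lambda>n. s n / t n)"
  shows "s \<longlonglongrightarrow> 0"
proof -
  have "l \<ge> 0"
    using lim s by (auto intro: LIMSEQ_le_const)
  have "l = 0"
  proof (rule ccontr)
    assume "l \<noteq> 0"
    with \<open>l \<ge> 0\<close> have l: "l > 0" by simp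
    have M: "M > 0"
      using t[of 0] growth[of 0] by simp
    have "eventually (\<lambda>n. l / 2 < s n) sequentially"
      using lim l by (intro order_tendstoD(1)) auto
    then have "eventually (\<lambda>n. norm (inverse (real (Suc n))) \<le> 2 * M / l * (s n / t n)) sequentially"
    proof eventually_elim
      case (elim n)
      have "l / 2 * t n \<le> s n * (M * (real n + 1))"
        using elim t[of n] growth[of n] l s[of n] by (intro mult_mono) auto
      then show ?case
        using t[of n] l by (simp add: field_simps)
    qed
    moreover have "summable (\<lambda>n. 2 * M / l * (s n / t n))"
      by (intro summable_mult sum)
    ultimately have "summable (\<lambda>n. inverse (real (Suc n)))"
      by (rule summable_comparison_test_ev)
    then show False
      using not_summable_harmonic[where 'a = real] summable_Suc_iff[of "\<lambda>n. inverse (real n)"]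
      by simp
  qed
  with lim show ?thesis by simp
qed


section \<open>Descent with momentum\<close>

text \<open>
  The sequence \<open>x\<close> is only required to satisfy the inequality that a proximal gradient step of unit
  step size from the extrapolated point \<open>x (Suc n) + ((t n - 1) / t (Suc n)) *\<^sub>R (x (Suc n) - x n)\<close>
  provides. The bound \<open>c\<close> on the increments of \<open>t\<close> lets \<open>(t n)\<^sup>2\<close> grow by at most
  \<open>2 * c * t (Suc n)\<close> in each step. As \<open>2 * c < 1\<close>, a fixed fraction of \<open>t (Suc n)\<close> remains; in the
  decrease of the energy it multiplies the gap \<open>F (x (Suc n)) - F z\<close>, and so it makes the gaps
  weighted by \<open>t\<close> summable.
\<close>
locale momentum_descent =
  fixes F :: "'a::euclidean_space \<Rightarrow> real" and C :: "'a set" and x :: "nat \<Rightarrow> 'a"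
    and t :: "nat \<Rightarrow> real" and c :: real
  assumes convex_F: "convex_on C F" and continuous_F: "continuous_on C F" and closed_C: "closed C"
    and x_in: "\<And>n. x n \<in> C"
    and t_ge_1: "\<And>n. 1 \<le> t n" and t_mono: "\<And>n. t n \<le> t (Suc n)"
    and t_step: "\<And>n. t (Suc n) - t n \<le> c" and c_less: "c < 1 / 2"
    and step: "\<And>n z. z \<in> C \<Longrightarrow>
      F (x (Suc (Suc n))) + (norm (z - x (Suc (Suc n))))\<^sup>2 / 2 \<le> F z +
      (norm (z - (x (Suc n) + ((t n - 1) / t (Suc n)) *\<^sub>R (x (Suc n) - x n))))\<^sup>2 / 2"
begin

text \<open>
  Extrapolation far beyond the next iterate: unlike the distance of the iterates to a minimizer, the
  distance of these points to it is part of a monotone quantity.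
\<close>
definition aux :: "nat \<Rightarrow> 'a" where
  "aux n = x n + t n *\<^sub>R (x (Suc n) - x n)"

definition energy :: "'a \<Rightarrow> nat \<Rightarrow> real" where
  "energy z n = (t n)\<^sup>2 * (F (x (Suc n)) - F z) + (norm (aux n - z))\<^sup>2 / 2"

lemma t_pos: "0 < t n" and t_nonneg: "0 \<le> t n" and t_nonzero: "t n \<noteq> 0"
  using t_ge_1[of n] by auto

lemma c_nonneg: "0 \<le> c"
  using t_mono[of 0] t_step[of 0] by linarith

text \<open>
  The step inequality is used at the point \<open>(1 - 1 / t (Suc n)) *\<^sub>R x (Suc n) + (1 / t (Suc n)) *\<^sub>R z\<close>:
  its distances to the new iterate and to the extrapolated point are the distances of \<open>z\<close> to
  consecutive auxiliary points, divided by \<open>t (Suc n)\<close>. The value of the momentum coefficient is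
  what makes the second identity hold.
\<close>
lemma energy_step:
  assumes z: "z \<in> C"
  shows "energy z (Suc n) + ((t n)\<^sup>2 - (t (Suc n))\<^sup>2 + t (Suc n)) * (F (x (Suc n)) - F z) \<le> energy z n"
proof -
  let ?T = "t (Suc n)"
  define v where "v = (1 - 1 / ?T) *\<^sub>R x (Suc n) + (1 / ?T) *\<^sub>R z"
  have T: "0 < ?T" "1 \<le> ?T" using t_pos t_ge_1 by auto
  have "convex C" using convex_F by (simp add: convex_on_def)
  then have v: "v \<in> C"
    unfolding v_def using T x_in z by (intro convexD) auto
  have Fv: "F v \<le> (1 - 1 / ?T) * F (x (Suc n)) + (1 / ?T) * F z"
    unfolding v_def using convex_onD[OF convex_F, of "1 / ?T" "x (Suc n)" z] T x_in z by simp
  have "v - x (Suc (Suc n)) = (1 / ?T) *\<^sub>R (?T *\<^sub>R (v - x (Suc (Suc n))))"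
    using T by simp
  also have "?T *\<^sub>R (v - x (Suc (Suc n))) = z - aux (Suc n)"
    using T by (simp add: v_def aux_def algebra_simps)
  finally have 1: "(norm (v - x (Suc (Suc n))))\<^sup>2 = (norm (aux (Suc n) - z))\<^sup>2 / ?T\<^sup>2"
    using T by (simp add: norm_minus_commute power_divide)
  let ?y = "x (Suc n) + ((t n - 1) / ?T) *\<^sub>R (x (Suc n) - x n)"
  have "v - ?y = (1 / ?T) *\<^sub>R (?T *\<^sub>R (v - ?y))"
    using T by simp
  also have "?T *\<^sub>R (v - ?y) = z - aux n"
  proof -
    have "?T *\<^sub>R v = (?T - 1) *\<^sub>R x (Suc n) + z"
      using T by (simp add: v_def algebra_simps)
    moreover have "?T *\<^sub>R ?y = ?T *\<^sub>R x (Suc n) + (t n - 1) *\<^sub>R (x (Suc n) - x n)"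
      using T by (simp add: scaleR_add_right)
    ultimately show ?thesis
      by (simp add: scaleR_diff_right aux_def) (simp add: algebra_simps)
  qed
  finally have 2: "(norm (v - ?y))\<^sup>2 = (norm (aux n - z))\<^sup>2 / ?T\<^sup>2"
    using T by (simp add: norm_minus_commute power_divide)
  have "F (x (Suc (Suc n))) + (norm (aux (Suc n) - z))\<^sup>2 / ?T\<^sup>2 / 2
      \<le> (1 - 1 / ?T) * F (x (Suc n)) + (1 / ?T) * F z + (norm (aux n - z))\<^sup>2 / ?T\<^sup>2 / 2"
    using step[OF v, of n] Fv unfolding 1 2 by linarith
  then have "?T\<^sup>2 * (F (x (Suc (Suc n))) + (norm (aux (Suc n) - z))\<^sup>2 / ?T\<^sup>2 / 2)
      \<le> ?T\<^sup>2 * ((1 - 1 / ?T) * F (x (Suc n)) + (1 / ?T) * F z + (norm (aux n - z))\<^sup>2 / ?T\<^sup>2 / 2)"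
    by (intro mult_left_mono) auto
  moreover have "?T\<^sup>2 * (F (x (Suc (Suc n))) + (norm (aux (Suc n) - z))\<^sup>2 / ?T\<^sup>2 / 2)
      = ?T\<^sup>2 * F (x (Suc (Suc n))) + (norm (aux (Suc n) - z))\<^sup>2 / 2"
    using T by (simp add: distrib_left)
  moreover have "?T\<^sup>2 * ((1 - 1 / ?T) * F (x (Suc n)) + (1 / ?T) * F z + (norm (aux n - z))\<^sup>2 / ?T\<^sup>2 / 2)
      = (?T\<^sup>2 - ?T) * F (x (Suc n)) + ?T * F z + (norm (aux n - z))\<^sup>2 / 2"
    using T by (simp add: field_simps power2_eq_square)
  ultimately show ?thesis
    unfolding energy_def by (simp add: algebra_simps)
qed

lemma t_sq_step: "(t (Suc n))\<^sup>2 - (t n)\<^sup>2 \<le> 2 * c * t (Suc n)"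
proof -
  have "(t (Suc n))\<^sup>2 - (t n)\<^sup>2 = (t (Suc n) - t n) * (t (Suc n) + t n)"
    by (simp add: power2_eq_square algebra_simps)
  also have "\<dots> \<le> c * (2 * t (Suc n))"
    using t_step[of n] t_mono[of n] t_nonneg[of n] c_nonneg by (intro mult_mono) auto
  finally show ?thesis by simp
qed

context
  fixes z assumes z_in: "z \<in> C" and z_min: "\<And>v. v \<in> C \<Longrightarrow> F z \<le> F v"
begin

lemma gap_nonneg: "0 \<le> F (x n) - F z"
  using z_min[OF x_in] by simp

lemma energy_nonneg: "0 \<le> energy z n"
  using gap_nonneg by (simp add: energy_def)

lemma energy_decrease:
  "energy z (Suc n) + (1 - 2 * c) * (t (Suc n) * (F (x (Suc n)) - F z)) \<le> energy z n"
proof -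
  have "(1 - 2 * c) * t (Suc n) * (F (x (Suc n)) - F z)
      \<le> ((t n)\<^sup>2 - (t (Suc n))\<^sup>2 + t (Suc n)) * (F (x (Suc n)) - F z)"
    using t_sq_step[of n] gap_nonneg by (intro mult_right_mono) (auto simp: algebra_simps)
  with energy_step[OF z_in, of n] show ?thesis by (simp add: mult.assoc)
qed

lemma convergent_energy: "convergent (energy z)"
  and summable_gap: "summable (\<lambda>n. t (Suc n) * (F (x (Suc n)) - F z))"
proof -
  have d: "0 \<le> (1 - 2 * c) * (t (Suc n) * (F (x (Suc n)) - F z))" for n
    using c_less t_nonneg gap_nonneg by simp
  note * = almost_decreasing_convergent[of "energy z"
      "\<lambda>n. (1 - 2 * c) * (t (Suc n) * (F (x (Suc n)) - F z))" "\<lambda>_. 0"]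
  show "convergent (energy z)"
    using energy_decrease energy_nonneg d by (intro *(1)) simp_all
  have "summable (\<lambda>n. (1 - 2 * c) * (t (Suc n) * (F (x (Suc n)) - F z)))"
    using energy_decrease energy_nonneg d by (intro *(2)) simp_all
  then show "summable (\<lambda>n. t (Suc n) * (F (x (Suc n)) - F z))"
    using c_less by simp
qed

definition scaled_gap :: "nat \<Rightarrow> real" where
  "scaled_gap n = (t n)\<^sup>2 * (F (x (Suc n)) - F z + (norm (x (Suc n) - x n))\<^sup>2 / 2)"

text \<open>
  The step inequality at the current iterate \<open>x (Suc n)\<close> says that the gap plus half the squared
  increment grows by at most the part of the momentum that is carried over. After multiplication by
  the square of \<open>t (Suc n)\<close>, the increment of index \<open>n\<close> has the factor
  \<open>(t n - 1)\<^sup>2 \<le> (t n)\<^sup>2 - t n\<close>, which leaves \<open>t n\<close> times the squared increment as a gain.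
\<close>
lemma scaled_gap_step:
  "scaled_gap (Suc n) + t n * ((norm (x (Suc n) - x n))\<^sup>2 / 2)
    \<le> scaled_gap n + 2 * c * (t (Suc n) * (F (x (Suc n)) - F z))"
proof -
  let ?T = "t (Suc n)" and ?d = "\<lambda>n. (norm (x (Suc n) - x n))\<^sup>2 / 2"
    and ?w = "\<lambda>n. F (x n) - F z"
  have "?w (Suc (Suc n)) + ?d (Suc n) \<le> ?w (Suc n) + ((t n - 1) / ?T)\<^sup>2 * ?d n"
    using step[OF x_in[of "Suc n"], of n]
    by (simp add: norm_minus_commute power_mult_distrib power_divide)
  then have "?T\<^sup>2 * (?w (Suc (Suc n)) + ?d (Suc n))
      \<le> ?T\<^sup>2 * (?w (Suc n) + ((t n - 1) / ?T)\<^sup>2 * ?d n)"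
    by (intro mult_left_mono) auto
  also have "\<dots> = ?T\<^sup>2 * ?w (Suc n) + (t n - 1)\<^sup>2 * ?d n"
    using t_nonzero[of "Suc n"] by (simp add: distrib_left power_divide)
  also have "(t n - 1)\<^sup>2 * ?d n \<le> ((t n)\<^sup>2 - t n) * ?d n"
    using t_ge_1[of n] by (intro mult_right_mono) (auto simp: power2_eq_square algebra_simps)
  also have "?T\<^sup>2 * ?w (Suc n) \<le> ((t n)\<^sup>2 + 2 * c * ?T) * ?w (Suc n)"
    using t_sq_step[of n] gap_nonneg by (intro mult_right_mono) auto
  finally have "scaled_gap (Suc n) \<le> ((t n)\<^sup>2 + 2 * c * ?T) * ?w (Suc n) + ((t n)\<^sup>2 - t n) * ?d n"
    by (simp add: scaled_gap_def)
  then show ?thesis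
    by (simp add: scaled_gap_def algebra_simps diff_divide_distrib)
qed

lemma scaled_gap_nonneg: "0 \<le> scaled_gap n"
  using gap_nonneg by (simp add: scaled_gap_def)

text \<open>
  The scaled gap converges since it decreases up to a summable error. Its quotient by \<open>t\<close> is
  summable, while the sum of \<open>1 / t n\<close> diverges, so the limit is 0.
\<close>
lemma scaled_gap_tendsto_0: "scaled_gap \<longlonglongrightarrow> 0"
proof -
  let ?d = "\<lambda>n. t n * ((norm (x (Suc n) - x n))\<^sup>2 / 2)"
    and ?w = "\<lambda>n. t (Suc n) * (F (x (Suc n)) - F z)"
  note * = almost_decreasing_convergent[of scaled_gap ?d "\<lambda>n. 2 * c * ?w n"]
  have conv: "convergent scaled_gap"
    using scaled_gap_step scaled_gap_nonneg t_nonneg gap_nonneg c_nonneg summable_gap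
    by (intro *(1)) (auto intro!: summable_mult)
  have d: "summable ?d"
    using scaled_gap_step scaled_gap_nonneg t_nonneg gap_nonneg c_nonneg summable_gap
    by (intro *(2)) (auto intro!: summable_mult)
  have "scaled_gap n / t n \<le> ?w n + ?d n" for n
  proof -
    have "scaled_gap n / t n = t n * (F (x (Suc n)) - F z) + ?d n"
      using t_nonzero[of n] by (simp add: scaled_gap_def power2_eq_square field_simps)
    also have "t n * (F (x (Suc n)) - F z) \<le> ?w n"
      using t_mono gap_nonneg by (intro mult_right_mono) auto
    finally show ?thesis by simp
  qed
  then have sum: "summable (\<lambda>n. scaled_gap n / t n)"
    using scaled_gap_nonneg t_nonneg
    by (intro summable_comparison_test'[OF summable_add[OF summable_gap d], of 0]) auto
  have "t n \<le> t 0 + c * real n" for n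
  proof (induction n)
    case (Suc n)
    then show ?case using t_step[of n] by (simp add: algebra_simps)
  qed simp
  moreover have "t 0 + c * real n \<le> (t 0 + c) * (real n + 1)" for n
    using t_nonneg[of 0] c_nonneg by (simp add: algebra_simps)
  ultimately have growth: "t n \<le> (t 0 + c) * (real n + 1)" for n
    using order_trans by blast
  show ?thesis
    using conv scaled_gap_nonneg t_pos growth sum
    by (auto simp: convergent_def intro: tendsto_0_if_summable_divide_linear)
qed

lemma gap_rate: "(\<lambda>n. (t n)\<^sup>2 * (F (x (Suc n)) - F z)) \<longlonglongrightarrow> 0"
  using gap_nonneg
  by (intro tendsto_sandwich[OF _ _ tendsto_const scaled_gap_tendsto_0])
    (auto simp: scaled_gap_def intro!: always_eventually mult_left_mono)

lemma increment_rate: "(\<lambda>n. t n *\<^sub>R (x (Suc n) - x n)) \<longlonglongrightarrow> 0"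
proof -
  have "(t n)\<^sup>2 * ((norm (x (Suc n) - x n))\<^sup>2 / 2) \<le> scaled_gap n" for n
    unfolding scaled_gap_def using gap_nonneg by (intro mult_left_mono) auto
  then have "(\<lambda>n. (t n)\<^sup>2 * ((norm (x (Suc n) - x n))\<^sup>2 / 2)) \<longlonglongrightarrow> 0"
    by (intro tendsto_sandwich[OF _ _ tendsto_const scaled_gap_tendsto_0])
      (auto intro!: always_eventually)
  then have "(\<lambda>n. sqrt (2 * ((t n)\<^sup>2 * ((norm (x (Suc n) - x n))\<^sup>2 / 2)))) \<longlonglongrightarrow> sqrt (2 * 0)"
    by (intro tendsto_intros)
  moreover have "sqrt (2 * ((t n)\<^sup>2 * ((norm (x (Suc n) - x n))\<^sup>2 / 2)))
      = norm (t n *\<^sub>R (x (Suc n) - x n))" for n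
    using t_nonneg[of n] by (simp add: real_sqrt_mult)
  ultimately have "(\<lambda>n. norm (t n *\<^sub>R (x (Suc n) - x n))) \<longlonglongrightarrow> 0"
    by simp
  then show ?thesis
    by (rule tendsto_norm_zero_cancel)
qed

text \<open>
  In the limit the energy consists of the distance term alone, and the auxiliary points approach
  the iterates.
\<close>
lemma distance_convergent: "convergent (\<lambda>n. norm (x n - z))"
proof -
  have "convergent (\<lambda>n. energy z n - (t n)\<^sup>2 * (F (x (Suc n)) - F z))"
    using convergent_energy gap_rate by (intro convergent_diff) (auto simp: convergent_def)
  then have "convergent (\<lambda>n. (norm (aux n - z))\<^sup>2 / 2)"
    by (simp add: energy_def)
  then obtain l where "(\<lambda>n. (norm (aux n - z))\<^sup>2 / 2) \<longlonglongrightarrow> l"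
    by (auto simp: convergent_def)
  then have "(\<lambda>n. sqrt (2 * ((norm (aux n - z))\<^sup>2 / 2))) \<longlonglongrightarrow> sqrt (2 * l)"
    by (intro tendsto_intros)
  then have lim: "(\<lambda>n. norm (aux n - z)) \<longlonglongrightarrow> sqrt (2 * l)"
    by simp
  have "(\<lambda>n. norm (x n - z) - norm (aux n - z)) \<longlonglongrightarrow> 0"
  proof (rule Lim_null_comparison)
    show "(\<lambda>n. norm (t n *\<^sub>R (x (Suc n) - x n))) \<longlonglongrightarrow> 0"
      using increment_rate by (rule tendsto_norm_zero)
    show "\<forall>\<^sub>F n in sequentially.
        norm (norm (x n - z) - norm (aux n - z)) \<le> norm (t n *\<^sub>R (x (Suc n) - x n))"
    proof (intro always_eventually allI)
      fix n
      have "x n - z - (aux n - z) = - (t n *\<^sub>R (x (Suc n) - x n))"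
        by (simp add: aux_def)
      then show "norm (norm (x n - z) - norm (aux n - z)) \<le> norm (t n *\<^sub>R (x (Suc n) - x n))"
        using norm_triangle_ineq3[of "x n - z" "aux n - z"] by (metis norm_minus_cancel real_norm_def)
    qed
  qed
  from tendsto_add[OF lim this] show ?thesis
    by (auto simp: convergent_def)
qed

lemma gap_tendsto_0: "(\<lambda>n. F (x n) - F z) \<longlonglongrightarrow> 0"
proof -
  have "(\<lambda>n. F (x (Suc n)) - F z) \<longlonglongrightarrow> 0"
  proof (rule tendsto_sandwich[OF _ _ tendsto_const gap_rate])
    have "1 * (F (x (Suc n)) - F z) \<le> (t n)\<^sup>2 * (F (x (Suc n)) - F z)" for n
      using t_ge_1 gap_nonneg by (intro mult_right_mono) auto
    then show "\<forall>\<^sub>F n in sequentially. F (x (Suc n)) - F z \<le> (t n)\<^sup>2 * (F (x (Suc n)) - F z)"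
      by simp
  qed (use gap_nonneg in auto)
  then show ?thesis
    by (simp add: filterlim_sequentially_Suc[of "\<lambda>n. F (x n) - F z"])
qed

end

text \<open>
  Opial's argument: a cluster point is a minimizer, and since the distance of \<open>x n\<close> to any
  minimizer converges, the distance to this one has limit 0.
\<close>
lemma iterates_converge:
  assumes z: "z \<in> C" "\<And>v. v \<in> C \<Longrightarrow> F z \<le> F v"
  obtains l where "x \<longlonglongrightarrow> l" "l \<in> C" "F l = F z"
proof -
  have "Bseq (\<lambda>n. norm (x n - z))"
    using distance_convergent[OF z] by (rule convergent_imp_Bseq)
  then obtain B where "\<And>n. norm (x n - z) \<le> B"
    by (auto simp: Bseq_def)
  then have "range x \<subseteq> cball z B"
    by (auto simp: dist_norm norm_minus_commute)
  then have "bounded (range x)"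
    using bounded_cball bounded_subset by blast
  then obtain l r where r: "strict_mono r" and lim: "(x \<circ> r) \<longlonglongrightarrow> l"
    using bounded_imp_convergent_subsequence by blast
  have l: "l \<in> C"
    using closed_sequentially[OF closed_C _ lim] x_in by simp
  have "(\<lambda>n. F ((x \<circ> r) n)) \<longlonglongrightarrow> F l"
    by (rule continuous_on_tendsto_compose[OF continuous_F lim l]) (simp add: x_in)
  moreover have F_lim: "(\<lambda>n. F (x n)) \<longlonglongrightarrow> F z"
    using gap_tendsto_0[OF z] by (simp add: LIM_zero_iff)
  have "(\<lambda>n. F ((x \<circ> r) n)) \<longlonglongrightarrow> F z"
    using LIMSEQ_subseq_LIMSEQ[OF F_lim r] by (simp add: o_def)
  ultimately have Fl: "F l = F z"
    by (rule LIMSEQ_unique)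
  then obtain m where m: "(\<lambda>n. norm (x n - l)) \<longlonglongrightarrow> m"
    using distance_convergent[of l] l z by (auto simp: convergent_def)
  have "(\<lambda>n. norm ((x \<circ> r) n - l)) \<longlonglongrightarrow> 0"
    by (intro tendsto_norm_zero LIM_zero lim)
  moreover have "(\<lambda>n. norm ((x \<circ> r) n - l)) \<longlonglongrightarrow> m"
    using LIMSEQ_subseq_LIMSEQ[OF m r] by (simp add: o_def)
  ultimately have "m = 0"
    using LIMSEQ_unique by blast
  with m have "x \<longlonglongrightarrow> l"
    by (simp add: LIM_zero_iff tendsto_norm_zero_iff)
  with l Fl show ?thesis using that by blast
qed

end


section \<open>The proximal gradient step in the preconditioned metric\<close>

definition rescale :: "('p \<Rightarrow> real) \<Rightarrow> real ^ 'p \<Rightarrow> real ^ 'p" where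
  "rescale q v = (\<chi> i. q i * v $ i)"

lemma rescale_nth [simp]: "rescale q v $ i = q i * v $ i"
  by (simp add: rescale_def)

lemma linear_rescale: "linear (rescale q)"
  by (auto simp: linear_iff vec_eq_iff algebra_simps)

lemma rescale_rescale:
  assumes "\<And>i. q i * r i = 1"
  shows "rescale q (rescale r v) = v"
  using assms by (simp add: vec_eq_iff mult.assoc[symmetric])

lemma norm_vec_sq: "(norm (v :: real ^ 'p))\<^sup>2 = (\<Sum>i\<in>UNIV. (v $ i)\<^sup>2)"
  unfolding power2_norm_eq_inner by (simp add: inner_vec_def power2_eq_square)

lemma pos_diag_mult_nth:
  assumes "pos_diag P"
  shows "(P *v v) $ i = P $ i $ i * v $ i"
proof -
  have "(P *v v) $ i = (\<Sum>j\<in>UNIV. P $ i $ j * v $ j)"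
    by (simp add: matrix_vector_mult_def)
  also have "\<dots> = (\<Sum>j\<in>UNIV. if j = i then P $ i $ i * v $ i else 0)"
    using assms by (intro sum.cong) (auto simp: pos_diag_def)
  finally show ?thesis by simp
qed

lemma pos_diag_inv_mult_nth:
  assumes P: "pos_diag P"
  shows "(matrix_inv P *v v) $ i = v $ i / P $ i $ i"
proof -
  have nz: "P $ i $ i \<noteq> 0" for i
    using P by (metis pos_diag_def less_irrefl)
  have "inj ((*v) P)"
    using nz by (auto simp: inj_def vec_eq_iff pos_diag_mult_nth[OF P])
  then have "invertible P"
    by (simp add: invertible_left_inverse matrix_left_invertible_injective)
  then have "P ** matrix_inv P = mat 1"
    unfolding invertible_def matrix_inv_def by (rule someI2_ex) simp
  then have "P *v (matrix_inv P *v v) = v"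
    by (simp add: matrix_vector_mul_assoc)
  then have "P $ i $ i * (matrix_inv P *v v) $ i = v $ i"
    by (metis pos_diag_mult_nth[OF P])
  then show ?thesis using nz[of i] by (simp add: field_simps)
qed

lemma wnorm_inv_sq:
  assumes P: "pos_diag P"
  shows "(wnorm (matrix_inv P) v)\<^sup>2 = (\<Sum>i\<in>UNIV. (v $ i)\<^sup>2 / P $ i $ i)"
proof -
  have "P $ i $ i > 0" for i using P by (simp add: pos_diag_def)
  then have "0 \<le> (\<Sum>i\<in>UNIV. (v $ i)\<^sup>2 / P $ i $ i)"
    by (intro sum_nonneg) (simp add: less_imp_le)
  then show ?thesis
    by (simp add: wnorm_def inner_vec_def pos_diag_inv_mult_nth[OF P] power2_eq_square)
qed

text \<open>
  Clipping at 0 minimizes each summand of the weighted distance separately; the excess of any other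
  point of the orthant is at least its weighted distance to the clipped point, which gives
  uniqueness.
\<close>
lemma prox_nonneg_ind:
  assumes P: "pos_diag P"
  shows "prox nonneg_ind (matrix_inv P) v = (\<chi> i. max (v $ i) 0)"
proof -
  define c where "c = (\<chi> i. max (v $ i) 0)"
  define h where "h u = ereal (1 / 2 * (wnorm (matrix_inv P) (u - v))\<^sup>2) + nonneg_ind u" for u
  have p: "P $ i $ i > 0" for i using P by (simp add: pos_diag_def)
  have c: "c \<in> nonneg_orthant" by (simp add: c_def nonneg_orthant_def)
  have excess: "(wnorm (matrix_inv P) (c - v))\<^sup>2 + (wnorm (matrix_inv P) (u - c))\<^sup>2
      \<le> (wnorm (matrix_inv P) (u - v))\<^sup>2" if "u \<in> nonneg_orthant" for u
  proof -
    have "((c - v) $ i)\<^sup>2 / P $ i $ i + ((u - c) $ i)\<^sup>2 / P $ i $ i \<le> ((u - v) $ i)\<^sup>2 / P $ i $ i" for i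
    proof -
      have "u $ i \<ge> 0" using that by (simp add: nonneg_orthant_def)
      then have "((c - v) $ i)\<^sup>2 + ((u - c) $ i)\<^sup>2 \<le> ((u - v) $ i)\<^sup>2"
        by (auto simp: c_def max_def power2_eq_square algebra_simps mult_nonneg_nonpos)
      then show ?thesis
        using p[of i] by (simp add: add_divide_distrib[symmetric] divide_right_mono less_imp_le)
    qed
    then show ?thesis
      unfolding wnorm_inv_sq[OF P] sum.distrib[symmetric] by (intro sum_mono) simp
  qed
  have pos: "0 < (wnorm (matrix_inv P) w)\<^sup>2" if "w \<noteq> 0" for w
  proof -
    from that obtain i where "w $ i \<noteq> 0" by (auto simp: vec_eq_iff)
    then show ?thesis
      unfolding wnorm_inv_sq[OF P] using p
      by (intro sum_pos2[of _ i]) (auto simp: less_imp_le)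
  qed
  have less: "h c < h u" if "u \<noteq> c" for u
  proof (cases "u \<in> nonneg_orthant")
    case True
    have "(wnorm (matrix_inv P) (c - v))\<^sup>2 < (wnorm (matrix_inv P) (u - v))\<^sup>2"
      using excess[OF True] pos[of "u - c"] that
      by (metis add_less_same_cancel1 not_less order_less_le_trans less_add_same_cancel1 right_minus_eq)
    then show ?thesis using True c by (simp add: h_def nonneg_ind_def)
  next
    case False
    then show ?thesis using c by (simp add: h_def nonneg_ind_def)
  qed
  have "is_arg_min h (\<lambda>_. True) u \<longleftrightarrow> u = c" for u
    using less by (auto simp: is_arg_min_def) (metis less_imp_not_less less_irrefl)
  then have "arg_min h (\<lambda>_. True) = c"
    by (simp add: arg_min_def)
  then show ?thesis
    by (simp add: prox_def h_def[abs_def] c_def)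
qed

lemma GDERIV_along_line:
  assumes "\<And>v. GDERIV \<phi> v :> G v"
  shows "((\<lambda>s. \<phi> (y + s *\<^sub>R d)) has_field_derivative d \<bullet> G (y + s *\<^sub>R d)) (at s)"
proof -
  have "((\<lambda>s. y + s *\<^sub>R d) has_derivative (\<lambda>h. h *\<^sub>R d)) (at s)"
    by (auto intro!: derivative_eq_intros)
  from has_derivative_compose[OF this assms[of "y + s *\<^sub>R d", unfolded gderiv_def]]
  show ?thesis
    by (simp add: has_field_derivative_def mult.commute[of _ "d \<bullet> _"] cong: if_cong)
qed

lemma convex_above_tangent:
  fixes \<phi> :: "'a::euclidean_space \<Rightarrow> real"
  assumes conv: "convex_on UNIV \<phi>" and G: "\<And>v. GDERIV \<phi> v :> G v"
  shows "\<phi> y + (z - y) \<bullet> G y \<le> \<phi> z"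
proof -
  let ?q = "\<lambda>s. \<phi> (y + s *\<^sub>R (z - y))"
  have "convex_on UNIV ?q"
  proof (rule convex_onI)
    fix t a b :: real
    assume "0 < t" "t < 1"
    have "y + ((1 - t) *\<^sub>R a + t *\<^sub>R b) *\<^sub>R (z - y)
        = (1 - t) *\<^sub>R (y + a *\<^sub>R (z - y)) + t *\<^sub>R (y + b *\<^sub>R (z - y))"
      by (simp add: algebra_simps)
    then show "?q ((1 - t) *\<^sub>R a + t *\<^sub>R b) \<le> (1 - t) * ?q a + t * ?q b"
      using convex_onD[OF conv, of t] \<open>0 < t\<close> \<open>t < 1\<close> by simp
  qed simp
  moreover have "(?q has_field_derivative (z - y) \<bullet> G y) (at 0 within UNIV)"
    using GDERIV_along_line[of \<phi> G y "z - y" 0, OF G] by simp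
  ultimately have "?q 1 - ?q 0 \<ge> (z - y) \<bullet> G y * (1 - 0)"
    by (intro convex_on_imp_above_tangent[where A = UNIV]) auto
  then show ?thesis by simp
qed

lemma lipschitz_gradient_upper_bound:
  fixes \<phi> :: "'a::euclidean_space \<Rightarrow> real"
  assumes L: "L-lipschitz_on UNIV G" and G: "\<And>v. GDERIV \<phi> v :> G v"
  shows "\<phi> z \<le> \<phi> y + (z - y) \<bullet> G y + L / 2 * (norm (z - y))\<^sup>2"
proof -
  define d where "d = z - y"
  define q where "q s = \<phi> (y + s *\<^sub>R d) - s * (d \<bullet> G y) - L / 2 * s\<^sup>2 * (norm d)\<^sup>2" for s
  have "q 1 \<le> q 0"
  proof (rule DERIV_nonpos_imp_nonincreasing[of 0 1 q])
    fix s :: real assume s: "0 \<le> s"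
    let ?D = "d \<bullet> G (y + s *\<^sub>R d) - d \<bullet> G y - L * s * (norm d)\<^sup>2"
    have "(q has_field_derivative ?D) (at s)"
      unfolding q_def using GDERIV_along_line[of \<phi> G y d s, OF G]
      by (auto intro!: derivative_eq_intros)
    moreover have "?D \<le> 0"
    proof -
      have "d \<bullet> G (y + s *\<^sub>R d) - d \<bullet> G y \<le> norm d * norm (G (y + s *\<^sub>R d) - G y)"
        using norm_cauchy_schwarz[of d "G (y + s *\<^sub>R d) - G y"] by (simp add: inner_diff_right)
      also have "\<dots> \<le> norm d * (L * norm (s *\<^sub>R d))"
        using lipschitz_onD[OF L, of "y + s *\<^sub>R d" y]
        by (intro mult_left_mono) (auto simp: dist_norm)
      finally show ?thesis
        using s by (simp add: power2_eq_square mult_ac)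
    qed
    ultimately show "\<exists>D. DERIV q s :> D \<and> D \<le> 0" by blast
  qed simp
  then show ?thesis by (simp add: q_def d_def)
qed

text \<open>
  Since \<open>L \<le> 1 / P $ i $ i\<close>, the quadratic upper bound of \<open>\<phi>\<close> at \<open>y\<close> is at most the one in the
  preconditioned metric, whose minimizer over the orthant is the new point; by convexity, the
  linearization of \<open>\<phi>\<close> at \<open>y\<close> is below \<open>\<phi>\<close> at \<open>z\<close>. The two estimates are linked by the
  variational inequality of the projection, which holds in every coordinate.
\<close>
lemma prox_gradient_step:
  fixes \<phi> :: "real ^ 'p \<Rightarrow> real"
  assumes conv: "convex_on UNIV \<phi>" and G: "\<And>v. GDERIV \<phi> v :> G v"
    and L: "L-lipschitz_on UNIV G"
    and P: "pos_diag P" and PL: "\<And>i. L * P $ i $ i \<le> 1"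
    and z: "z \<in> nonneg_orthant"
  defines "D \<equiv> rescale (\<lambda>i. 1 / sqrt (P $ i $ i))"
  shows "\<phi> (T_map P G y) + (norm (D z - D (T_map P G y)))\<^sup>2 / 2 \<le> \<phi> z + (norm (D z - D y))\<^sup>2 / 2"
proof -
  define u where "u = T_map P G y"
  have p: "P $ i $ i > 0" for i using P by (simp add: pos_diag_def)
  have u: "u $ i = max (y $ i - P $ i $ i * G y $ i) 0" for i
    by (simp add: u_def T_map_def prox_nonneg_ind[OF P] pos_diag_mult_nth[OF P])
  have D: "(norm (D v - D w))\<^sup>2 = (\<Sum>i\<in>UNIV. ((v - w) $ i)\<^sup>2 / P $ i $ i)" for v w
  proof -
    have "D v - D w = D (v - w)"
      unfolding D_def by (simp add: linear_diff[OF linear_rescale])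
    then show ?thesis
      using p by (simp add: norm_vec_sq D_def power_divide less_imp_le)
  qed
  have "(u $ i - z $ i) * G y $ i + L / 2 * (u $ i - y $ i)\<^sup>2 + (z $ i - u $ i)\<^sup>2 / P $ i $ i / 2
      \<le> (z $ i - y $ i)\<^sup>2 / P $ i $ i / 2" for i
  proof -
    let ?p = "P $ i $ i" and ?g = "G y $ i"
    have zi: "z $ i \<ge> 0" using z by (simp add: nonneg_orthant_def)
    \<comment> \<open>The clipped coordinate is the projection of the gradient step to \<open>[0, \<infinity>)\<close>.\<close>
    have var: "(y $ i - ?p * ?g - u $ i) * (z $ i - u $ i) \<le> 0"
      using zi unfolding u by (auto simp: max_def mult_nonpos_nonneg)
    have "L * ?p * (u $ i - y $ i)\<^sup>2 \<le> 1 * (u $ i - y $ i)\<^sup>2"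
      using PL by (intro mult_right_mono) auto
    with var have "?p * (2 * (u $ i - z $ i) * ?g + L * (u $ i - y $ i)\<^sup>2) + (z $ i - u $ i)\<^sup>2
        \<le> (z $ i - y $ i)\<^sup>2"
      by (simp add: power2_eq_square algebra_simps)
    then have "(?p * (2 * (u $ i - z $ i) * ?g + L * (u $ i - y $ i)\<^sup>2) + (z $ i - u $ i)\<^sup>2) / ?p
        \<le> (z $ i - y $ i)\<^sup>2 / ?p"
      using p[of i] by (simp add: divide_right_mono less_imp_le)
    then have "2 * (u $ i - z $ i) * ?g + L * (u $ i - y $ i)\<^sup>2 + (z $ i - u $ i)\<^sup>2 / ?p
        \<le> (z $ i - y $ i)\<^sup>2 / ?p"
      using p[of i] by (simp add: add_divide_distrib)
    moreover have "e + L / 2 * q + r / 2 \<le> s / 2" if "2 * e + L * q + r \<le> s" for e q r s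
      using that by (simp add: field_simps)
    ultimately show ?thesis by (simp only: mult.assoc)
  qed
  then have "(\<Sum>i\<in>UNIV. (u $ i - z $ i) * G y $ i + L / 2 * (u $ i - y $ i)\<^sup>2
        + (z $ i - u $ i)\<^sup>2 / P $ i $ i / 2)
      \<le> (\<Sum>i\<in>UNIV. (z $ i - y $ i)\<^sup>2 / P $ i $ i / 2)"
    by (rule sum_mono)
  then have "(u - z) \<bullet> G y + L / 2 * (norm (u - y))\<^sup>2 + (norm (D z - D u))\<^sup>2 / 2
      \<le> (norm (D z - D y))\<^sup>2 / 2"
    by (simp add: D norm_vec_sq[of "u - y"] inner_vec_def sum.distrib sum_distrib_left
        sum_divide_distrib)
  with convex_above_tangent[OF conv G, of y z] lipschitz_gradient_upper_bound[OF L G, of u y]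
  show ?thesis
    unfolding u_def[symmetric] by (simp add: inner_diff_left)
qed


section \<open>The momentum schedule\<close>

text \<open>
  For \<open>\<omega> < 1\<close> the increments tend to 0, and for \<open>\<omega> = 1\<close> they are equal to \<open>a\<close>; this is where
  \<open>a < 1/2\<close> enters.
\<close>
lemma schedule_eventually:
  fixes a b \<omega> :: real
  assumes "\<omega> \<in> {0<..<1} \<and> a > 0 \<or> \<omega> = 1 \<and> a \<in> {0<..<1/2}"
  obtains c K where "c < 1 / 2" "2 \<le> K"
    "\<And>k. K \<le> k \<Longrightarrow> 1 \<le> a * real k powr \<omega> + b"
    "\<And>k. K \<le> k \<Longrightarrow> (a * real (Suc k) powr \<omega> + b) - (a * real k powr \<omega> + b) \<le> c"
proof -
  let ?t = "\<lambda>k. a * real k powr \<omega> + b"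
  have pos: "0 < a" "0 < \<omega>" using assms by auto
  have "filterlim ?t at_top sequentially"
    using pos by real_asymp
  then have 1: "\<forall>\<^sub>F k in sequentially. 1 \<le> ?t k"
    by (simp add: filterlim_at_top)
  have "\<exists>c<1/2. \<forall>\<^sub>F k in sequentially. ?t (Suc k) - ?t k \<le> c"
  proof (cases "\<omega> = 1")
    case True
    then show ?thesis
      using assms by (intro exI[of _ a]) (auto simp: algebra_simps)
  next
    case False
    then have "\<omega> < 1" using assms by auto
    with pos have "(\<lambda>k. ?t (Suc k) - ?t k) \<longlonglongrightarrow> 0"
      by real_asymp
    then have "\<forall>\<^sub>F k in sequentially. ?t (Suc k) - ?t k < 1 / 4"
      by (rule order_tendstoD) simp
    then show ?thesis
      by (intro exI[of _ "1 / 4"]) (auto elim: eventually_mono)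
  qed
  then obtain c where c: "c < 1 / 2" and 2: "\<forall>\<^sub>F k in sequentially. ?t (Suc k) - ?t k \<le> c"
    by blast
  from eventually_conj[OF 1 2] obtain K where "\<And>k. K \<le> k \<Longrightarrow> 1 \<le> ?t k \<and> ?t (Suc k) - ?t k \<le> c"
    by (auto simp: eventually_sequentially)
  then show ?thesis
    using c that[of c "max K 2"] by auto
qed

text \<open>
  The index shift matches the weight \<open>t k\<close> of the energy at step \<open>k\<close> with the iterate \<open>k + 1\<close>; since
  \<open>t k\<close> is asymptotic to \<open>a * (k + 1) powr \<omega>\<close>, it does not change the order.
\<close>
lemma smallo_if_schedule_rate:
  fixes a b \<omega> :: real and g :: "nat \<Rightarrow> real"
  assumes "0 < a" "0 < \<omega>" and lim: "(\<lambda>k. (a * real k powr \<omega> + b) ^ m * g (Suc k)) \<longlonglongrightarrow> 0"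
  shows "g \<in> o(\<lambda>k. 1 / real k powr (real m * \<omega>))"
proof (rule smalloI_tendsto)
  let ?t = "\<lambda>k. a * real k powr \<omega> + b"
  have "(\<lambda>k. real (Suc k) powr \<omega> / ?t k) \<longlonglongrightarrow> inverse a"
    using assms(1,2) by real_asymp
  from tendsto_mult[OF tendsto_power[OF this, of m] lim]
  have "(\<lambda>k. (real (Suc k) powr \<omega> / ?t k) ^ m * (?t k ^ m * g (Suc k))) \<longlonglongrightarrow> 0"
    by simp
  moreover have "filterlim ?t at_top sequentially"
    using assms(1,2) by real_asymp
  then have "\<forall>\<^sub>F k in sequentially. 0 < ?t k"
    by (simp add: filterlim_at_top_dense)
  then have "\<forall>\<^sub>F k in sequentially. (real (Suc k) powr \<omega> / ?t k) ^ m * (?t k ^ m * g (Suc k))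
      = g (Suc k) / (1 / real (Suc k) powr (real m * \<omega>))"
    by eventually_elim (simp add: power_divide powr_power mult.commute)
  ultimately have "(\<lambda>k. g (Suc k) / (1 / real (Suc k) powr (real m * \<omega>))) \<longlonglongrightarrow> 0"
    by (rule Lim_transform_eventually)
  then show "(\<lambda>k. g k / (1 / real k powr (real m * \<omega>))) \<longlonglongrightarrow> 0"
    by (rule filterlim_sequentially_Suc[THEN iffD1])
  show "\<forall>\<^sub>F k in sequentially. 1 / real k powr (real m * \<omega>) \<noteq> 0"
    using eventually_gt_at_top[of 0] by eventually_elim simp
qed


section \<open>Convergence rates and convergence of the iterates\<close>

theorem theorem10:
  fixes A :: "real ^ ('n::{finite,linorder} \<times> 'n) ^ 'm" and \<gamma> g :: "real ^ 'm"
    and \<epsilon> lam1 lam2 L a b \<omega> :: real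
    and \<phi> :: "'n img \<Rightarrow> real" and G :: "'n img \<Rightarrow> 'n img"
    and \<Phi> :: "'n img \<Rightarrow> ereal" and fstar :: "'n img"
    and P :: "real ^ ('n \<times> 'n) ^ ('n \<times> 'n)"
    and t \<theta> :: "nat \<Rightarrow> real" and f :: "nat \<Rightarrow> 'n img"
  assumes "\<And>i j. A $ i $ j \<ge> 0" and "\<gamma> \<in> nonneg_orthant" and "g \<in> nonneg_orthant"
    and "\<epsilon> > 0" and "lam1 > 0" and "lam2 > 0"
    and "\<And>x. x \<in> nonneg_orthant \<Longrightarrow> \<phi> x = pet_objective A \<gamma> g \<epsilon> lam1 lam2 x"
    and "convex_on UNIV \<phi>"
    and "\<And>x. GDERIV \<phi> x :> G x"
    and "L-lipschitz_on UNIV G"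
    and "\<And>x. \<Phi> x = ereal (pet_objective A \<gamma> g \<epsilon> lam1 lam2 x) + nonneg_ind x"
    and "is_arg_min \<Phi> (\<lambda>_. True) fstar"
    and "pos_diag P"
    and "(MAX i. P $ i $ i) \<le> 1 / L"
    and "\<And>k. t k = a * real k powr \<omega> + b"
    and "b \<notin> {- (a * real k powr \<omega>) | k. k \<ge> 1}"
    and "\<And>k. k \<ge> 1 \<Longrightarrow> \<theta> k = (t (k - 1) - 1) / t k"
    and "\<And>k. k \<ge> 1 \<Longrightarrow> f (k + 1) = T_map P G (f k + \<theta> k *\<^sub>R (f k - f (k - 1)))"
    and "\<omega> \<in> {0<..<1} \<and> a > 0 \<or> \<omega> = 1 \<and> a \<in> {0<..<1/2}"
  shows "(\<lambda>k. norm (f k - f (k - 1))) \<in> o(\<lambda>k. 1 / real k powr \<omega>) \<and>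
    (\<exists>r. (\<forall>\<^sub>F k in sequentially. \<Phi> (f k) - \<Phi> fstar = ereal (r k)) \<and>
         r \<in> o(\<lambda>k. 1 / real k powr (2 * \<omega>))) \<and>
    (\<exists>x. f \<longlonglongrightarrow> x \<and> is_arg_min \<Phi> (\<lambda>_. True) x)"
proof -
  note \<phi>_eq = assms(7) and conv = assms(8) and G = assms(9) and L = assms(10)
    and \<Phi>_eq = assms(11) and min = assms(12) and P = assms(13) and P_max = assms(14)
    and t_eq = assms(15) and \<theta>_eq = assms(17) and iter = assms(18) and schedule = assms(19)
  have a: "0 < a" and \<omega>: "0 < \<omega>" using schedule by auto
  have p: "P $ i $ i > 0" for i using P unfolding pos_diag_def by blast
  have PL: "L * P $ i $ i \<le> 1" for i
  proof -
    have "P $ i $ i \<le> (MAX i. P $ i $ i)" by (intro Max_ge) auto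
    with P_max have le: "P $ i $ i \<le> 1 / L" by linarith
    with p[of i] have "0 < 1 / L" by linarith
    then show ?thesis using le by (simp add: field_simps)
  qed
  let ?C = "nonneg_orthant :: 'n img set"
  have \<Phi>_C: "\<Phi> v = ereal (\<phi> v)" if "v \<in> ?C" for v
    using that by (simp add: \<Phi>_eq \<phi>_eq nonneg_ind_def)
  have \<Phi>_outside: "\<Phi> v = \<infinity>" if "v \<notin> ?C" for v
    using that by (simp add: \<Phi>_eq nonneg_ind_def)
  have is_min_iff: "is_arg_min \<Phi> (\<lambda>_. True) v \<longleftrightarrow> v \<in> ?C \<and> (\<forall>w\<in>?C. \<phi> v \<le> \<phi> w)" for v
  proof
    assume v: "is_arg_min \<Phi> (\<lambda>_. True) v"
    have le: "\<Phi> v \<le> \<Phi> w" for w using v by (simp add: is_arg_min_linorder)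
    have "0 \<in> ?C" by (simp add: nonneg_orthant_def)
    then have v_in: "v \<in> ?C" using le[of 0] \<Phi>_C \<Phi>_outside by fastforce
    moreover have "\<phi> v \<le> \<phi> w" if "w \<in> ?C" for w
      using le[of w] that v_in by (simp add: \<Phi>_C)
    ultimately show "v \<in> ?C \<and> (\<forall>w\<in>?C. \<phi> v \<le> \<phi> w)" by blast
  next
    assume v: "v \<in> ?C \<and> (\<forall>w\<in>?C. \<phi> v \<le> \<phi> w)"
    have "\<Phi> v \<le> \<Phi> w" for w
      using v \<Phi>_C \<Phi>_outside by (cases "w \<in> ?C") auto
    then show "is_arg_min \<Phi> (\<lambda>_. True) v" by (simp add: is_arg_min_linorder)
  qed
  have fstar: "fstar \<in> ?C" "\<And>w. w \<in> ?C \<Longrightarrow> \<phi> fstar \<le> \<phi> w"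
    using min is_min_iff by auto
  have T_in: "T_map P G v \<in> ?C" for v
    by (simp add: T_map_def prox_nonneg_ind[OF P] nonneg_orthant_def)
  have f_in: "f k \<in> ?C" if "2 \<le> k" for k
    using iter[of "k - 1"] T_in that by simp

  \<comment> \<open>From index \<open>K\<close> on, the schedule is regular and the iterates are in the orthant; the two
    starting points need not be.\<close>
  obtain c K where c: "c < 1 / 2" and K: "2 \<le> K"
    and t_ge: "\<And>k. K \<le> k \<Longrightarrow> 1 \<le> t k" and t_step: "\<And>k. K \<le> k \<Longrightarrow> t (Suc k) - t k \<le> c"
    using schedule_eventually[OF schedule, of b] unfolding t_eq by metis
  \<comment> \<open>In the coordinates \<open>D v\<close> the preconditioned norm is the Euclidean one.\<close>
  define D :: "'n img \<Rightarrow> 'n img" where "D = rescale (\<lambda>i. 1 / sqrt (P $ i $ i))"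
  define D' :: "'n img \<Rightarrow> 'n img" where "D' = rescale (\<lambda>i. sqrt (P $ i $ i))"
  have lin: "linear D" "linear D'" by (simp_all add: D_def D'_def linear_rescale)
  have D'D [simp]: "D' (D v) = v" and DD' [simp]: "D (D' v) = v" for v
    using p by (auto simp: D_def D'_def intro!: rescale_rescale) (metis less_irrefl)+
  have D_C: "D v \<in> ?C" and D'_C: "D' v \<in> ?C" if "v \<in> ?C" for v
    using that p by (simp_all add: D_def D'_def nonneg_orthant_def less_imp_le)
  have bounded_D': "bounded_linear D'"
    using lin(2) by (simp add: linear_conv_bounded_linear)
  have D'_lim: "(\<lambda>n. D' (s n)) \<longlonglongrightarrow> D' l" if "s \<longlonglongrightarrow> l" for s l
    using bounded_linear.tendsto[OF bounded_D' that] .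
  have \<phi>_cont: "continuous_on UNIV \<phi>"
    using G by (intro continuous_at_imp_continuous_on)
      (auto simp: gderiv_def intro: has_derivative_continuous)
  have C_eq: "?C = (\<Inter>i. {v. 0 \<le> v $ i})"
    by (auto simp: nonneg_orthant_def)

  interpret md: momentum_descent "\<lambda>v. \<phi> (D' v)" ?C "\<lambda>n. D (f (n + K))" "\<lambda>n. t (n + K)" c
  proof
    show "convex_on ?C (\<lambda>v. \<phi> (D' v))"
    proof (rule convex_onI)
      show "convex ?C"
        by (auto simp: convex_def nonneg_orthant_def)
      fix s :: real and v w assume "0 < s" "s < 1"
      then show "\<phi> (D' ((1 - s) *\<^sub>R v + s *\<^sub>R w)) \<le> (1 - s) * \<phi> (D' v) + s * \<phi> (D' w)"
        using convex_onD[OF conv, of s "D' v" "D' w"]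
        by (simp add: linear_add[OF lin(2)] linear_scale[OF lin(2)])
    qed
    show "continuous_on ?C (\<lambda>v. \<phi> (D' v))"
      using continuous_on_compose2[OF \<phi>_cont linear_continuous_on[OF bounded_D']] by simp
    show "closed ?C"
      unfolding C_eq by (intro closed_INT ballI closed_Collect_le continuous_intros)
    show "D (f (n + K)) \<in> ?C" for n
      using f_in K D_C by simp
    show "1 \<le> t (n + K)" for n
      by (intro t_ge) simp
    show "t (n + K) \<le> t (Suc n + K)" for n
      using a \<omega> by (simp add: t_eq powr_mono2)
    show "t (Suc n + K) - t (n + K) \<le> c" for n
      using t_step[of "n + K"] by simp
    show "c < 1 / 2" by (fact c)
  next
    fix n z assume z: "z \<in> ?C"
    let ?k = "Suc (n + K)"
    define y where "y = f ?k + \<theta> ?k *\<^sub>R (f ?k - f (n + K))"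
    have f_next: "f (Suc ?k) = T_map P G y"
      using iter[of ?k] by (simp add: y_def)
    have "D y = D (f ?k) + \<theta> ?k *\<^sub>R (D (f ?k) - D (f (n + K)))"
      by (simp add: y_def linear_add[OF lin(1)] linear_scale[OF lin(1)] linear_diff[OF lin(1)])
    moreover have "\<theta> ?k = (t (n + K) - 1) / t ?k"
      using \<theta>_eq[of ?k] by simp
    ultimately have "D y = D (f (Suc n + K))
        + ((t (n + K) - 1) / t (Suc n + K)) *\<^sub>R (D (f (Suc n + K)) - D (f (n + K)))"
      by simp
    with prox_gradient_step[OF conv G L P PL D'_C[OF z], of y]
    show "\<phi> (D' (D (f (Suc (Suc n) + K)))) + (norm (z - D (f (Suc (Suc n) + K))))\<^sup>2 / 2 \<le> \<phi> (D' z)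
        + (norm (z - (D (f (Suc n + K)) + ((t (n + K) - 1) / t (Suc n + K)) *\<^sub>R
            (D (f (Suc n + K)) - D (f (n + K))))))\<^sup>2 / 2"
      unfolding D_def[symmetric] by (simp add: f_next)
  qed

  have Dmin: "D fstar \<in> ?C" "\<And>v. v \<in> ?C \<Longrightarrow> \<phi> (D' (D fstar)) \<le> \<phi> (D' v)"
    using fstar D_C D'_C by simp_all

  have "(\<lambda>k. norm (f k - f (k - 1))) \<in> o(\<lambda>k. 1 / real k powr (real 1 * \<omega>))"
  proof (rule smallo_if_schedule_rate[OF a \<omega>])
    have "(\<lambda>n. t (n + K) *\<^sub>R (f (Suc (n + K)) - f (n + K))) \<longlonglongrightarrow> 0"
      using D'_lim[OF md.increment_rate[OF Dmin]]
      by (simp add: linear_scale[OF lin(2)] linear_diff[OF lin(2)] linear_0[OF lin(2)])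
    then have "(\<lambda>k. t k *\<^sub>R (f (Suc k) - f k)) \<longlonglongrightarrow> 0"
      by (rule LIMSEQ_offset)
    then have "(\<lambda>k. norm (t k *\<^sub>R (f (Suc k) - f k))) \<longlonglongrightarrow> 0"
      by (rule tendsto_norm_zero)
    then show "(\<lambda>k. (a * real k powr \<omega> + b) ^ 1 * norm (f (Suc k) - f (Suc k - 1))) \<longlonglongrightarrow> 0"
      by (subst tendsto_rabs_zero_iff[symmetric]) (simp add: t_eq abs_mult)
  qed
  moreover have "\<exists>r. (\<forall>\<^sub>F k in sequentially. \<Phi> (f k) - \<Phi> fstar = ereal (r k)) \<and>
      r \<in> o(\<lambda>k. 1 / real k powr (2 * \<omega>))"
  proof (intro exI conjI)
    show "\<forall>\<^sub>F k in sequentially. \<Phi> (f k) - \<Phi> fstar = ereal (\<phi> (f k) - \<phi> fstar)"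
      using eventually_ge_at_top[of 2]
      by eventually_elim (simp add: \<Phi>_C f_in fstar)
    have "(\<lambda>k. \<phi> (f k) - \<phi> fstar) \<in> o(\<lambda>k. 1 / real k powr (real 2 * \<omega>))"
    proof (rule smallo_if_schedule_rate[OF a \<omega>])
      have "(\<lambda>n. (t (n + K))\<^sup>2 * (\<phi> (f (Suc (n + K))) - \<phi> fstar)) \<longlonglongrightarrow> 0"
        using md.gap_rate[OF Dmin] by simp
      then have "(\<lambda>k. (t k)\<^sup>2 * (\<phi> (f (Suc k)) - \<phi> fstar)) \<longlonglongrightarrow> 0"
        by (rule LIMSEQ_offset)
      then show "(\<lambda>k. (a * real k powr \<omega> + b)\<^sup>2 * (\<phi> (f (Suc k)) - \<phi> fstar)) \<longlonglongrightarrow> 0"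
        by (simp add: t_eq)
    qed
    then show "(\<lambda>k. \<phi> (f k) - \<phi> fstar) \<in> o(\<lambda>k. 1 / real k powr (2 * \<omega>))"
      by simp
  qed
  moreover obtain l where l: "(\<lambda>n. D (f (n + K))) \<longlonglongrightarrow> l" "l \<in> ?C" "\<phi> (D' l) = \<phi> (D' (D fstar))"
    using md.iterates_converge[OF Dmin] by blast
  have "f \<longlonglongrightarrow> D' l"
    using D'_lim[OF l(1)] by (auto intro: LIMSEQ_offset)
  moreover have "is_arg_min \<Phi> (\<lambda>_. True) (D' l)"
    using l fstar D'_C by (simp add: is_min_iff)
  ultimately show ?thesis by auto
qed

end
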